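(* For every integer $n \ge 2$ with $n \ne 3$, the extended Lucas cube whose vertices are labelled by $n$-bit binary strings, i.e. the graph $\mathrm{ELC}(n+2)$, is Hamiltonian (it has a Hamiltonian cycle).
   Context: Define sets of binary strings $V_1(k)$, consisting of strings of length $k-2$, by $V_1(2)=\{\lambda\}$ ($\lambda$ the empty string), $V_1(3)=\{0,1\}$, $V_1(4)=\{00,01,10,11\}$, and $V_1(k)=0V_1(k-1)\cup 10V_1(k-2)$ for $k\ge 5$, where $uS=\{us: s\in S\}$ denotes concatenation. Define sets of binary strings $V_2(k)$, consisting of strings of length $k-2$, by $V_2(4)=\{00,01,10,11\}$ and, for $k\ge 5$, $V_2(k)=0V_1(k-1)\cup 10V_1(k-3)0$, where $10S0=\{10s0: s\in S\}$. For example $V_2(5)=\{000,001,010,011,100\}$. For $k \ge 4$, the extended Lucas cube $\mathrm{ELC}(k)$ is the simple undirected graph with vertex set $V_2(k)$ in which two vertices are adjacent if and only if they differ in exactly one bit position. *)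

theory Defs
  imports "Graph_Theory.Graph_Theory"
begin

text \<open>A binary string is a list of bits, with \<^term>\<open>False\<close> for 0 and \<^term>\<open>True\<close> for 1.\<close>

type_synonym bitstring = "bool list"

definition prepend :: "bitstring \<Rightarrow> bitstring set \<Rightarrow> bitstring set" where
  "prepend u S = (\<lambda>s. u @ s) ` S"

definition append_to :: "bitstring set \<Rightarrow> bitstring \<Rightarrow> bitstring set" where
  "append_to S u = (\<lambda>s. s @ u) ` S"

text \<open>
  The mathematical definition of \<open>V1 k\<close> starts at \<open>k = 2\<close>; the empty sets at 0 and 1 are
  dummy values that the recursion never reaches. See \<open>V1_2\<close> to \<open>V1_rec\<close> below for the
  defining equations with numerals.
\<close>

fun V1 :: "nat \<Rightarrow> bitstring set" where
  "V1 0 = {}"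
| "V1 (Suc 0) = {}"
| "V1 (Suc (Suc 0)) = {[]}"
| "V1 (Suc (Suc (Suc 0))) = {[False], [True]}"
| "V1 (Suc (Suc (Suc (Suc 0)))) =
     {[False, False], [False, True], [True, False], [True, True]}"
| "V1 (Suc (Suc (Suc (Suc (Suc k))))) =
     prepend [False] (V1 (Suc (Suc (Suc (Suc k))))) \<union>
     prepend [True, False] (V1 (Suc (Suc (Suc k))))"

lemma V1_2: "V1 2 = {[]}"
  by (simp add: numeral_eq_Suc)

lemma V1_3: "V1 3 = {[False], [True]}"
  by (simp add: numeral_eq_Suc)

lemma V1_4: "V1 4 = {[False, False], [False, True], [True, False], [True, True]}"
  by (simp add: numeral_eq_Suc)

lemma V1_rec:
  assumes "5 \<le> k"
  shows "V1 k = prepend [False] (V1 (k - 1)) \<union> prepend [True, False] (V1 (k - 2))"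
proof -
  have "k = Suc (Suc (Suc (Suc (Suc (k - 5)))))"
    using assms by simp
  then obtain m where "k = Suc (Suc (Suc (Suc (Suc m))))" ..
  then show ?thesis by (simp add: numeral_2_eq_2)
qed

text \<open>As for \<open>V1\<close>, only the values from \<open>k = 4\<close> on are meaningful.\<close>

definition V2 :: "nat \<Rightarrow> bitstring set" where
  "V2 k =
     (if k < 4 then {}
      else if k = 4 then {[False, False], [False, True], [True, False], [True, True]}
      else prepend [False] (V1 (k - 1)) \<union>
           append_to (prepend [True, False] (V1 (k - 3))) [False])"

lemma V2_5:
  "V2 5 = {[False, False, False], [False, False, True], [False, True, False],
           [False, True, True], [True, False, False]}"
  by (auto simp: V2_def prepend_def append_to_def V1_4 V1_2)

definition differ_in_one :: "bitstring \<Rightarrow> bitstring \<Rightarrow> bool" where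
  "differ_in_one u v \<longleftrightarrow>
     length u = length v \<and> card {i. i < length u \<and> u ! i \<noteq> v ! i} = 1"

text \<open>
  A simple undirected graph is represented by a \<^const>\<open>pair_graph\<close>: a finite, loop-free,
  symmetric digraph whose arcs are ordered pairs of vertices.
\<close>

definition ELC :: "nat \<Rightarrow> bitstring pair_pre_digraph" where
  "ELC k =
     \<lparr> pverts = V2 k, parcs = {(u, v). u \<in> V2 k \<and> v \<in> V2 k \<and> differ_in_one u v} \<rparr>"

lemma finite_V1: "finite (V1 k)"
  by (induction k rule: V1.induct) (simp_all add: prepend_def)

lemma length_V1: "s \<in> V1 k \<Longrightarrow> length s = k - 2"
  by (induction k arbitrary: s rule: V1.induct) (auto simp: prepend_def)

lemma length_V2: "s \<in> V2 k \<Longrightarrow> length s = k - 2"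
  by (auto simp: V2_def prepend_def append_to_def dest!: length_V1 split: if_splits)

lemma pair_graph_ELC: "pair_graph (ELC k)"
proof
  show "finite (pverts (ELC k))"
    by (simp add: ELC_def V2_def prepend_def append_to_def finite_V1)
  then have "finite (pverts (ELC k) \<times> pverts (ELC k))"
    by simp
  then show "finite (parcs (ELC k))"
    by (rule rev_finite_subset) (auto simp: ELC_def)
  show "symmetric (with_proj (ELC k))"
  proof -
    have "differ_in_one u v \<Longrightarrow> differ_in_one v u" for u v
      by (auto simp: differ_in_one_def eq_commute[of "u ! _"])
    then show ?thesis
      by (auto simp: symmetric_def arcs_ends_def arc_to_ends_def ELC_def intro!: symI)
  qed
qed (auto simp: ELC_def differ_in_one_def)

text \<open>
  In a symmetric digraph the library's \<^const>\<open>pre_digraph.cycle\<close> also admits going along an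
  edge and straight back, as a cycle with two arcs. Requiring at least three arcs leaves
  exactly the cycles of the underlying undirected graph.
\<close>

definition (in pre_digraph) hamiltonian_cycle :: "'b awalk \<Rightarrow> bool" where
  "hamiltonian_cycle p \<longleftrightarrow>
     cycle p \<and> 3 \<le> length p \<and> (\<exists>u. awalk u p u \<and> set (awalk_verts u p) = verts G)"

definition (in pre_digraph) hamiltonian :: bool where
  "hamiltonian \<longleftrightarrow> (\<exists>p. hamiltonian_cycle p)"

end

theory Submission
  imports Defs
begin

text \<open>
  Write \<open>C n\<close> for the graph on the strings of length \<open>n\<close> in \<^term>\<open>V1 (n + 2)\<close>.
  By induction \<open>C n\<close> has a Hamiltonian circuit that starts with \<open>0^n, 010^(n-2)\<close> and ends
  with \<open>10^(n-1)\<close>: cut the circuit of \<open>0 C (n-1)\<close> at the edge between \<open>0^n\<close> and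
  \<open>0010^(n-3)\<close>, cut the circuit of \<open>10 C (n-2)\<close> at the edge between \<open>10^(n-1)\<close>
  and \<open>1010^(n-3)\<close>, and connect the ends by flipping the first bit. For \<open>n \<ge> 4\<close> the same
  two cuts join the circuits of \<open>0 C (n-1)\<close> and \<open>10 C (n-3) 0\<close>, which cover the
  extended Lucas cube.
\<close>

text \<open>For symmetric \<open>R\<close> the two ends of an edge also form a circuit. This
  degenerate case is wanted: \<open>gray (Suc 0)\<close> is such a list and serves as a piece in
  joins.\<close>

definition circuit :: "('a \<Rightarrow> 'a \<Rightarrow> bool) \<Rightarrow> 'a list \<Rightarrow> bool" where
  "circuit R xs \<longleftrightarrow> xs \<noteq> [] \<and> distinct xs \<and> successively R xs \<and> R (last xs) (hd xs)"

text \<open>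
  The edge from \<^term>\<open>hd xs\<close> to its successor and the edge that closes \<open>ys\<close> are
  replaced by two edges between \<open>xs\<close> and \<open>ys\<close>.
\<close>

definition join :: "'a list \<Rightarrow> 'a list \<Rightarrow> 'a list" where
  "join xs ys = hd xs # rev (tl xs) @ rev ys"

lemma
  assumes "tl xs \<noteq> []" "ys \<noteq> []"
  shows hd_join: "hd (join xs ys) = hd xs"
    and hd_tl_join: "hd (tl (join xs ys)) = last xs"
    and last_join: "last (join xs ys) = hd ys"
    and tl_join_ne: "tl (join xs ys) \<noteq> []"
    and set_join: "set (join xs ys) = set xs \<union> set ys"
  using assms by (cases xs; auto simp: join_def hd_rev last_rev)+

text \<open>The joined list steps from \<open>hd xs\<close> to \<open>last xs\<close>, runs
  backwards to \<open>hd (tl xs)\<close>, crosses to \<open>last ys\<close>, runs backwards to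
  \<open>hd ys\<close> and crosses back to \<open>hd xs\<close>. Symmetry of \<open>R\<close>
  permits the reversals.\<close>

lemma circuit_join:
  assumes "symp R" "circuit R xs" "circuit R ys" "tl xs \<noteq> []" "set xs \<inter> set ys = {}"
    and "R (hd xs) (hd ys)" "R (hd (tl xs)) (last ys)"
  shows "circuit R (join xs ys)"
proof -
  have "(\<lambda>x y. R y x) = R"
    using assms(1) by (auto simp: fun_eq_iff dest: sympD)
  then have rev: "successively R (rev zs) \<longleftrightarrow> successively R zs" for zs
    by (simp only: successively_rev)
  obtain x zs where xs: "xs = x # zs" "zs \<noteq> []"
    using assms(4) by (cases xs) auto
  have "R x (last zs)" "R (hd ys) x"
    using assms(1,2,6) xs by (auto simp: circuit_def dest: sympD)
  then show ?thesis
    using assms(2,3,5,7) xs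
    by (auto simp: circuit_def join_def successively_append_iff successively_Cons
        hd_rev last_rev rev simp del: successively_rev)
qed

lemma circuit_map:
  assumes "circuit R xs" "inj f" "\<And>x y. R x y \<Longrightarrow> R (f x) (f y)"
  shows "circuit R (map f xs)"
proof -
  have "successively (\<lambda>x y. R (f x) (f y)) xs"
    using assms(1,3) unfolding circuit_def by (blast intro: successively_mono)
  then show ?thesis
    using assms
    by (simp add: circuit_def distinct_map successively_map last_map hd_map
        inj_on_subset[OF assms(2)])
qed

lemma differ_in_one_Nil [simp]: "\<not> differ_in_one [] v" "\<not> differ_in_one u []"
  by (auto simp: differ_in_one_def)

text \<open>A new first bit shifts the differing positions by one and adds position 0 exactly if
  \<open>x\<close> and \<open>y\<close> differ. As a simp rule this decides adjacency bit by
  bit.\<close>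

lemma differ_in_one_Cons [simp]:
  "differ_in_one (x # u) (y # v) \<longleftrightarrow> (if x = y then differ_in_one u v else u = v)"
proof (cases "length u = length v")
  case True
  let ?D = "{i. i < length u \<and> u ! i \<noteq> v ! i}"
  have "{i. i < length (x # u) \<and> (x # u) ! i \<noteq> (y # v) ! i} =
      (if x = y then {} else {0}) \<union> Suc ` ?D"
  proof (rule set_eqI)
    fix i
    show "i \<in> {i. i < length (x # u) \<and> (x # u) ! i \<noteq> (y # v) ! i} \<longleftrightarrow>
        i \<in> (if x = y then {} else {0}) \<union> Suc ` ?D"
      by (cases i) auto
  qed
  moreover have "card (Suc ` ?D) = card ?D" "card (insert 0 (Suc ` ?D)) = Suc (card ?D)"
    by (auto simp: card_image card_insert_if)
  moreover have "card ?D = 0 \<longleftrightarrow> u = v"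
    using True by (auto intro: nth_equalityI)
  ultimately show ?thesis
    using True by (auto simp: differ_in_one_def)
qed (auto simp: differ_in_one_def)

lemma symp_differ_in_one: "symp differ_in_one"
proof (rule sympI)
  show "differ_in_one v u" if "differ_in_one u v" for u v
    using that by (auto simp: differ_in_one_def eq_commute[of "u ! _"])
qed

lemma differ_in_one_snoc:
  "differ_in_one u v \<Longrightarrow> differ_in_one (u @ [c]) (v @ [c])"
proof (induction u arbitrary: v)
  case (Cons x u)
  then show ?case by (cases v) (auto split: if_splits)
qed simp

text \<open>A cyclic Gray code of \<open>V1 (n + 2)\<close>, with base cases where \<open>V1\<close>
  has them. \<open>gray 0\<close> is a single vertex and no circuit, so the circuits start at
  \<open>Suc n\<close>.\<close>

fun gray :: "nat \<Rightarrow> bitstring list" where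
  "gray 0 = [[]]"
| "gray (Suc 0) = [[False], [True]]"
| "gray (Suc (Suc 0)) = [[False, False], [False, True], [True, True], [True, False]]"
| "gray (Suc (Suc (Suc n))) =
     join (map (Cons False) (gray (Suc (Suc n))))
       (map (\<lambda>s. True # False # s) (gray (Suc n)))"

text \<open>A join keeps the head of its first piece, ends with the head of the second, and has the
  last entry of the first in second place. So the second entry follows from the other ends without a
  further induction.\<close>

lemma gray_ends:
  shows "tl (gray (Suc n)) \<noteq> []"
    and "hd (gray (Suc n)) = replicate (Suc n) False"
    and "last (gray (Suc n)) = True # replicate n False"
    and "hd (tl (gray (Suc (Suc n)))) = False # True # replicate n False"
proof -
  have "tl (gray (Suc n)) \<noteq> [] \<and> hd (gray (Suc n)) = replicate (Suc n) False \<and>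
    last (gray (Suc n)) = True # replicate n False" for n
  proof (induction n rule: less_induct)
    case (less n)
    consider "n = 0" | "n = Suc 0" | m where "n = Suc (Suc m)"
      by (metis not0_implies_Suc)
    then show ?case
    proof cases
      case (3 m)
      then have "tl (gray (Suc (Suc m))) \<noteq> []" "tl (gray (Suc m)) \<noteq> []"
        "hd (gray (Suc (Suc m))) = replicate (Suc (Suc m)) False"
        "hd (gray (Suc m)) = replicate (Suc m) False"
        using less.IH[of m] less.IH[of "Suc m"] by auto
      moreover from this have "gray (Suc (Suc m)) \<noteq> []" "gray (Suc m) \<noteq> []"
        by auto
      ultimately show ?thesis
        by (simp add: 3 hd_join last_join tl_join_ne hd_map flip: map_tl)
    qed auto
  qed
  note ends = this
  then show "tl (gray (Suc n)) \<noteq> []" "hd (gray (Suc n)) = replicate (Suc n) False"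
    "last (gray (Suc n)) = True # replicate n False"
    by blast+
  show "hd (tl (gray (Suc (Suc n)))) = False # True # replicate n False"
  proof (cases n)
    case (Suc m)
    have "gray (Suc (Suc m)) \<noteq> []" "gray (Suc m) \<noteq> []"
      using ends[of m] ends[of "Suc m"] by auto
    then show ?thesis
      using ends[of "Suc m"] by (simp add: Suc hd_tl_join last_map flip: map_tl)
  qed simp
qed

lemma gray_ne: "gray (Suc n) \<noteq> []"
  using gray_ends(1)[of n] by auto

lemma set_gray: "set (gray n) = V1 (n + 2)"
proof (induction n rule: gray.induct)
  case (4 n)
  have "set (gray (Suc (Suc (Suc n)))) =
      Cons False ` set (gray (Suc (Suc n))) \<union> (\<lambda>s. True # False # s) ` set (gray (Suc n))"
    by (simp add: set_join gray_ends(1) gray_ne flip: map_tl)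
  then show ?case
    by (simp add: 4 prepend_def)
qed auto

text \<open>The pieces are disjoint by their first bit, and \<open>gray_ends\<close> shows that the
  two connecting pairs agree in all later bits.\<close>

lemma circuit_gray: "circuit differ_in_one (gray (Suc n))"
proof (induction n rule: less_induct)
  case (less n)
  consider "n = 0" | "n = Suc 0" | m where "n = Suc (Suc m)"
    by (metis not0_implies_Suc)
  then show ?case
  proof cases
    case (3 m)
    then have "circuit differ_in_one (gray (Suc (Suc m)))"
      "circuit differ_in_one (gray (Suc m))"
      using less.IH by auto
    then show ?thesis
      unfolding 3 gray.simps(4)
      by (intro circuit_join symp_differ_in_one circuit_map)
        (auto simp: inj_def gray_ends gray_ne hd_map last_map simp flip: map_tl
          simp del: gray.simps)
  qed (auto simp: circuit_def)
qed

text \<open>\<open>V2 4\<close> equals \<open>V1 4\<close>. From 4 on, \<open>n - 3\<close> is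
  positive, so the second piece comes from a circuit. At 3 there is no circuit: \<open>V2 5\<close>
  has five strings, and flipping one bit changes parity, so every closed walk is even.\<close>

lemma circuit_V2:
  assumes "2 \<le> n" "n \<noteq> 3"
  obtains xs where "circuit differ_in_one xs" "set xs = V2 (n + 2)" "3 \<le> length xs"
proof (cases "n = 2")
  case True
  have "circuit differ_in_one (gray 2)"
    using circuit_gray[of 1] by (simp add: numeral_2_eq_2)
  then show ?thesis
    using True by (intro that[of "gray 2"]) (auto simp: V2_def numeral_2_eq_2)
next
  case False
  with assms have "4 \<le> n"
    by linarith
  then obtain m where n: "n = m + 4"
    by (metis add.commute le_Suc_ex)
  let ?xs = "map (Cons False) (gray (Suc (Suc (Suc m))))"
  let ?ys = "map (\<lambda>s. True # False # s @ [False]) (gray (Suc m))"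
  let ?zs = "join ?xs ?ys"
  \<comment> \<open>The appended 0 only lengthens the final block of zeros in the end strings of
    \<open>gray (Suc m)\<close>, so they still match the ends of \<open>?xs\<close>.\<close>
  have *: "replicate m False @ [False] = replicate (Suc m) False"
    by (simp add: replicate_append_same)
  have "circuit differ_in_one ?zs"
    by (intro circuit_join symp_differ_in_one circuit_map circuit_gray)
      (auto simp: inj_def gray_ends gray_ne hd_map last_map differ_in_one_snoc *
        simp flip: map_tl simp del: gray.simps)
  moreover have "set ?zs = V2 (n + 2)"
  proof -
    have "set ?zs = set ?xs \<union> set ?ys"
      by (rule set_join) (simp_all add: gray_ends gray_ne flip: map_tl del: gray.simps)
    also have "\<dots> = prepend [False] (V1 (m + 5)) \<union>
        append_to (prepend [True, False] (V1 (m + 3))) [False]"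
      by (simp add: set_gray prepend_def append_to_def image_image numeral_eq_Suc
          del: gray.simps V1.simps)
    also have "\<dots> = V2 (n + 2)"
      by (simp add: V2_def n add.commute)
    finally show ?thesis .
  qed
  moreover have "3 \<le> length ?zs"
  proof -
    have "tl ?xs \<noteq> []" "?ys \<noteq> []"
      by (simp_all add: gray_ends gray_ne flip: map_tl del: gray.simps)
    then show ?thesis
      by (cases "tl ?xs"; cases ?ys) (auto simp: join_def)
  qed
  ultimately show ?thesis
    by (rule that)
qed

text \<open>The library's walks are arc lists, whereas circuits are vertex lists;
  \<open>vwalk_arcs\<close> translates, and the vertex list can be recovered from the walk.\<close>

lemma awalk_verts_vwalk_arcs:
  "pre_digraph.awalk_verts (with_proj G) u (vwalk_arcs (u # xs)) = u # xs"
  by (induction xs arbitrary: u) (auto simp: pre_digraph.awalk_verts.simps)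

lemma cas_vwalk_arcs:
  "pre_digraph.cas (with_proj G) u (vwalk_arcs (u # xs)) (last (u # xs))"
  by (induction xs arbitrary: u) (auto simp: pre_digraph.cas.simps)

lemma set_vwalk_arcs_successively:
  "successively R xs \<Longrightarrow> set (vwalk_arcs xs) \<subseteq> {(u, v). u \<in> set xs \<and> v \<in> set xs \<and> R u v}"
  by (induction xs rule: vwalk_arcs.induct) auto

lemma hamiltonian_if_circuit:
  assumes "circuit (\<lambda>u v. (u, v) \<in> parcs G) xs" "set xs = pverts G" "3 \<le> length xs"
  shows "pre_digraph.hamiltonian (with_proj G)"
proof -
  obtain u ys where xs: "xs = u # ys"
    using assms(3) by (cases xs) auto
  \<comment> \<open>Repeating \<open>u\<close> closes the walk and makes the number of arcs equal to
    \<open>length xs\<close>. A cycle asks for distinct vertices only after the first, here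
    \<open>ys @ [u]\<close>.\<close>
  let ?p = "vwalk_arcs (u # ys @ [u])"
  have "successively (\<lambda>u v. (u, v) \<in> parcs G) (u # ys @ [u])"
    using assms(1) unfolding append_Cons[symmetric] successively_append_iff
    by (simp add: circuit_def xs)
  from set_vwalk_arcs_successively[OF this] have "set ?p \<subseteq> parcs G"
    by auto
  then have awalk: "pre_digraph.awalk (with_proj G) u ?p u"
    using cas_vwalk_arcs[of G u "ys @ [u]"] assms(2)
    by (auto simp: pre_digraph.awalk_def xs)
  have length: "length ?p = length xs"
    using vwalk_length_simp[of "u # ys @ [u]", unfolded vwalk_length_def] by (simp add: xs)
  have verts: "pre_digraph.awalk_verts (with_proj G) u ?p = u # ys @ [u]"
    by (rule awalk_verts_vwalk_arcs)
  have "pre_digraph.hamiltonian_cycle (with_proj G) ?p"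
    unfolding pre_digraph.hamiltonian_cycle_def pre_digraph.cycle_def
  proof (intro conjI exI)
    show "distinct (tl (pre_digraph.awalk_verts (with_proj G) u ?p))"
      unfolding verts using assms(1) by (auto simp: circuit_def xs)
    show "set (pre_digraph.awalk_verts (with_proj G) u ?p) = verts (with_proj G)"
      unfolding verts using assms(2) by (auto simp: xs)
  qed (use awalk length assms(3) in auto)
  then show ?thesis
    by (auto simp: pre_digraph.hamiltonian_def)
qed

theorem lemma1:
  fixes n :: nat
  assumes "2 \<le> n" and "n \<noteq> 3"
  shows "pre_digraph.hamiltonian (with_proj (ELC (n + 2)))"
proof -
  obtain xs where xs: "circuit differ_in_one xs" "set xs = V2 (n + 2)" "3 \<le> length xs"
    using circuit_V2[OF assms] .
  then have ne: "xs \<noteq> []" and "successively differ_in_one xs"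
    by (simp_all add: circuit_def)
  from this(2) have "successively (\<lambda>u v. (u, v) \<in> parcs (ELC (n + 2))) xs"
    by (rule successively_mono) (simp add: ELC_def xs(2))
  \<comment> \<open>The closing edge of \<open>ELC\<close> also needs both its ends to be
    vertices.\<close>
  moreover have "last xs \<in> V2 (n + 2)" "hd xs \<in> V2 (n + 2)"
    using ne unfolding xs(2)[symmetric] by simp_all
  ultimately have "circuit (\<lambda>u v. (u, v) \<in> parcs (ELC (n + 2))) xs"
    using xs(1) by (simp add: circuit_def ELC_def)
  then show ?thesis
    using xs(2,3) by (intro hamiltonian_if_circuit) (simp_all add: ELC_def)
qed

end
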